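(* $\operatorname{add}(\mathcal{N})_{\mathrm{game}}^{\mathrm{II}} = \operatorname{cov}(\mathcal{M})$.
   Context: $\operatorname{cov}(\mathcal{M})$ is the least number of meager sets needed to cover $2^\omega$. For $k\in\omega$, $[\omega]^{k+1}$ denotes the set of subsets of $\omega$ of size $k+1$. For $\mathcal{A}\subseteq\omega^\omega$, the anti-localizing game with respect to $\mathcal{A}$: at round $k$, Player I plays $a_k\in[\omega]^{k+1}$ and then Player II plays $i_k\in\{0,1\}$. Player II wins iff $i_k=1$ for infinitely many $k$ and there is $x\in\mathcal{A}$ with $\{k: i_k=1\}=\{k: x(k)\notin a_k\}$. $\operatorname{add}(\mathcal{N})_{\mathrm{game}}^{\mathrm{II}}$ is the least $|\mathcal{A}|$ such that Player II has a winning strategy in the anti-localizing game with respect to $\mathcal{A}$. *)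

theory Defs
  imports "HOL-Analysis.Analysis"
begin

text \<open>Cantor space 2^omega is the type nat => bool with the product topology
  (bool carries the discrete topology).\<close>

definition nowhere_dense :: "(nat \<Rightarrow> bool) set \<Rightarrow> bool" where
  "nowhere_dense X \<longleftrightarrow> interior (closure X) = {}"

definition meager :: "(nat \<Rightarrow> bool) set \<Rightarrow> bool" where
  "meager X \<longleftrightarrow> (\<exists>N :: nat \<Rightarrow> (nat \<Rightarrow> bool) set.
      (\<forall>n. nowhere_dense (N n)) \<and> X \<subseteq> (\<Union>n. N n))"

definition meager_cover :: "(nat \<Rightarrow> bool) set set \<Rightarrow> bool" where
  "meager_cover F \<longleftrightarrow> (\<forall>X\<in>F. meager X) \<and> \<Union>F = UNIV"

definition cov_M_witness :: "(nat \<Rightarrow> bool) set set \<Rightarrow> bool" where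
  "cov_M_witness F \<longleftrightarrow> meager_cover F \<and>
     (\<forall>G. meager_cover G \<longrightarrow> (card_of F, card_of G) \<in> ordLeq)"

text \<open>Anti-localizing game. Player I's moves: a k, a subset of nat of size k+1.
  A strategy for Player II maps the list [a 0, ..., a k] of I's moves so far
  to II's move i_k (True = 1, False = 0).\<close>

definition legal_I_play :: "(nat \<Rightarrow> nat set) \<Rightarrow> bool" where
  "legal_I_play a \<longleftrightarrow> (\<forall>k. finite (a k) \<and> card (a k) = Suc k)"

definition II_moves :: "(nat set list \<Rightarrow> bool) \<Rightarrow> (nat \<Rightarrow> nat set) \<Rightarrow> nat \<Rightarrow> bool" where
  "II_moves \<sigma> a k = \<sigma> (map a [0..<Suc k])"

definition II_wins_play :: "(nat \<Rightarrow> nat) set \<Rightarrow> (nat \<Rightarrow> nat set) \<Rightarrow> (nat \<Rightarrow> bool) \<Rightarrow> bool" where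
  "II_wins_play A a i \<longleftrightarrow> infinite {k. i k} \<and>
     (\<exists>x\<in>A. {k. i k} = {k. x k \<notin> a k})"

definition II_winning_strategy :: "(nat \<Rightarrow> nat) set \<Rightarrow> (nat set list \<Rightarrow> bool) \<Rightarrow> bool" where
  "II_winning_strategy A \<sigma> \<longleftrightarrow>
     (\<forall>a. legal_I_play a \<longrightarrow> II_wins_play A a (II_moves \<sigma> a))"

definition II_has_winning_strategy :: "(nat \<Rightarrow> nat) set \<Rightarrow> bool" where
  "II_has_winning_strategy A \<longleftrightarrow> (\<exists>\<sigma>. II_winning_strategy A \<sigma>)"

definition addN_game_II_witness :: "(nat \<Rightarrow> nat) set \<Rightarrow> bool" where
  "addN_game_II_witness A \<longleftrightarrow> II_has_winning_strategy A \<and>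
     (\<forall>B. II_has_winning_strategy B \<longrightarrow> (card_of A, card_of B) \<in> ordLeq)"

end

theory Submission
  imports Defs
begin

text \<open>A member of the family is consistent with a winning strategy of Player II only on a nowhere
  dense set of plays, since from any position Player I can catch it forever; so the members give a
  meager cover. Conversely, given a meager cover \<^term>\<open>F\<close>, some family of \<open>|F \<times> \<omega>|\<close> functions
  has, for every play, a member that is never caught, and Player II wins by always answering 1.
  Otherwise two such plays would yield a point outside the cover, as in Bartoszynski's
  characterization of cov(M): catching growth functions gives blocks which infinitely often contain
  an interval suitable for escaping a given meager set, and catching codes of patterns on these
  blocks then escapes all members of \<^term>\<open>F\<close> at once.\<close>

section \<open>Nowhere dense and meager sets in Cantor space\<close>

definition cylinder :: "(nat \<Rightarrow> bool) \<Rightarrow> nat \<Rightarrow> (nat \<Rightarrow> bool) set" where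
  "cylinder c m = {d. \<forall>i<m. d i = c i}"

lemma cylinder_self: "c \<in> cylinder c m"
  by (simp add: cylinder_def)

lemma cylinder_antimono: "m \<le> n \<Longrightarrow> cylinder c n \<subseteq> cylinder c m"
  by (auto simp: cylinder_def)

lemma open_cylinder: "open (cylinder c m)"
proof -
  have "open ((\<lambda>d::nat \<Rightarrow> bool. d i) -` {c i})" for i
    by (intro open_vimage continuous_on_product_coordinates open_discrete)
  then have "open (\<Inter>i\<in>{..<m}. (\<lambda>d::nat \<Rightarrow> bool. d i) -` {c i})"
    by (intro open_INT) auto
  also have "(\<Inter>i\<in>{..<m}. (\<lambda>d::nat \<Rightarrow> bool. d i) -` {c i}) = cylinder c m"
    by (auto simp: cylinder_def)
  finally show ?thesis .
qed

lemma open_contains_cylinder: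
  assumes "open U" "c \<in> U"
  obtains m where "cylinder c m \<subseteq> U"
proof -
  have "openin (product_topology (\<lambda>i::nat. euclidean :: bool topology) UNIV) U"
    using assms(1) by (simp add: euclidean_product_topology)
  from product_topology_open_contains_basis[OF this assms(2)]
  obtain X where X: "c \<in> Pi\<^sub>E UNIV X" "finite {i. X i \<noteq> UNIV}" "Pi\<^sub>E UNIV X \<subseteq> U"
    by auto
  then obtain m where m: "\<And>i. X i \<noteq> UNIV \<Longrightarrow> i < m"
    using finite_nat_set_iff_bounded[of "{i. X i \<noteq> UNIV}"] by auto
  have "d \<in> Pi\<^sub>E UNIV X" if "d \<in> cylinder c m" for d
    unfolding PiE_UNIV_domain Pi_iff
  proof
    fix i
    have "c i \<in> X i" using X(1) by (rule PiE_mem) simp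
    show "d i \<in> X i"
    proof (cases "X i = UNIV")
      case True
      show ?thesis unfolding True by (rule UNIV_I)
    next
      case False
      have "d i = c i" using m[OF False] that unfolding cylinder_def by blast
      then show ?thesis using \<open>c i \<in> X i\<close> by (simp only:)
    qed
  qed
  then have "cylinder c m \<subseteq> U" using X(3) by (meson subset_iff)
  then show thesis by (rule that)
qed

lemma nowhere_dense_iff_cylinder:
  "nowhere_dense X \<longleftrightarrow>
    (\<forall>c m. \<exists>d m'. d \<in> cylinder c m \<and> m \<le> m' \<and> cylinder d m' \<inter> X = {})"
proof
  assume X: "nowhere_dense X"
  show "\<forall>c m. \<exists>d m'. d \<in> cylinder c m \<and> m \<le> m' \<and> cylinder d m' \<inter> X = {}"
  proof (intro allI)
    fix c m
    have "\<not> cylinder c m \<subseteq> closure X"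
      using X interior_maximal[OF _ open_cylinder] cylinder_self
      unfolding nowhere_dense_def by blast
    then obtain d where d: "d \<in> cylinder c m" "d \<in> - closure X"
      by blast
    obtain k where k: "cylinder d k \<subseteq> - closure X"
      using open_contains_cylinder[OF _ d(2)] by (metis closed_closure open_Compl)
    have "cylinder d (max m k) \<inter> X = {}"
      using k cylinder_antimono[of k "max m k" d] closure_subset[of X] by auto
    then show "\<exists>d m'. d \<in> cylinder c m \<and> m \<le> m' \<and> cylinder d m' \<inter> X = {}"
      using d(1) max.cobounded1 by blast
  qed
next
  assume R: "\<forall>c m. \<exists>d m'. d \<in> cylinder c m \<and> m \<le> m' \<and> cylinder d m' \<inter> X = {}"
  show "nowhere_dense X"
    unfolding nowhere_dense_def
  proof (rule ccontr)
    assume "interior (closure X) \<noteq> {}"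
    then obtain c where "c \<in> interior (closure X)" by blast
    then obtain m where m: "cylinder c m \<subseteq> interior (closure X)"
      using open_contains_cylinder[OF open_interior] by metis
    obtain d m' where d: "d \<in> cylinder c m" "cylinder d m' \<inter> X = {}"
      using R by blast
    have "d \<in> closure X" using d(1) m interior_subset by blast
    moreover have "cylinder d m' \<inter> closure X = {}"
      using d(2) open_Int_closure_eq_empty[OF open_cylinder] by blast
    ultimately show False using cylinder_self by blast
  qed
qed

definition matches :: "(nat \<Rightarrow> bool) \<Rightarrow> (nat \<Rightarrow> bool) \<Rightarrow> nat set \<Rightarrow> bool" where
  "matches c d I \<longleftrightarrow> (\<forall>i\<in>I. c i = d i)"

lemma matches_subset: "matches c d I \<Longrightarrow> J \<subseteq> I \<Longrightarrow> matches c d J"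
  by (auto simp: matches_def)

text \<open>One pattern above \<open>m\<close> serves all pairs: treat them one after another, each
  time lengthening the pattern. A longer pattern still works for the earlier pairs, since matching
  it implies matching the shorter one.\<close>

lemma common_escape:
  assumes "finite P" "\<And>s X. (s, X) \<in> P \<Longrightarrow> nowhere_dense X"
  shows "\<exists>l\<ge>m. \<exists>t. \<forall>(s, X)\<in>P. \<forall>e\<in>cylinder s m. matches e t {m..<l} \<longrightarrow> e \<notin> X"
  using assms
proof (induction P)
  case empty
  then show ?case by auto
next
  case (insert p P)
  obtain s X where p: "p = (s, X)" by (cases p)
  have "\<exists>l\<ge>m. \<exists>t. \<forall>(s, X)\<in>P. \<forall>e\<in>cylinder s m. matches e t {m..<l} \<longrightarrow> e \<notin> X"
    using insert.prems by (intro insert.IH) blast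
  then obtain l t where l: "m \<le> l"
    and t: "\<And>s X e. (s, X) \<in> P \<Longrightarrow> e \<in> cylinder s m \<Longrightarrow> matches e t {m..<l} \<Longrightarrow> e \<notin> X"
    by blast
  \<comment> \<open>Gluing \<open>s\<close> to the old pattern makes the cylinder avoiding
    \<open>X\<close> extend both.\<close>
  define c where "c = (\<lambda>i. if i < m then s i else t i)"
  obtain d m' where d: "d \<in> cylinder c l" "l \<le> m'" "cylinder d m' \<inter> X = {}"
    using insert.prems[of s X] p unfolding nowhere_dense_iff_cylinder by blast
  have dt: "d i = t i" if "i \<in> {m..<l}" for i
    using d(1) that by (auto simp: cylinder_def c_def)
  have ds: "d i = s i" if "i < m" for i
    using d(1) that l by (auto simp: cylinder_def c_def)
  have old: "e \<notin> Y" if "(r, Y) \<in> P" "e \<in> cylinder r m" "matches e d {m..<m'}" for r Y e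
    using t[OF that(1,2)] that(3) d(2) dt by (auto simp: matches_def)
  have new: "e \<notin> X" if "e \<in> cylinder s m" "matches e d {m..<m'}" for e
  proof -
    have "e i = d i" if "i < m'" for i
      using \<open>e \<in> cylinder s m\<close> \<open>matches e d {m..<m'}\<close> that ds
      by (cases "i < m") (auto simp: cylinder_def matches_def)
    then have "e \<in> cylinder d m'" by (auto simp: cylinder_def)
    then show ?thesis using d(3) by auto
  qed
  show ?case
    using old new p l d(2)
    by (intro exI[of _ m'] conjI exI[of _ d]) auto
qed

text \<open>There are finitely many prefixes of length \<open>m\<close>, so a single pattern from
  \<open>m\<close> on avoids \<open>N 0\<close>, ..., \<open>N m\<close> whatever the prefix is. A
  point of \<open>N r\<close> thus fails every pattern with \<open>m\<close> at least
  \<open>r\<close>.\<close>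

lemma meager_escape_intervals:
  assumes "meager M"
  obtains f :: "nat \<Rightarrow> nat" and t :: "nat \<Rightarrow> nat \<Rightarrow> bool" where
    "mono f" "\<And>e. e \<in> M \<Longrightarrow> \<exists>r. \<forall>m\<ge>r. \<not> matches e (t m) {m..<f m}"
proof -
  obtain N :: "nat \<Rightarrow> (nat \<Rightarrow> bool) set"
    where N: "\<And>n. nowhere_dense (N n)" "M \<subseteq> (\<Union>n. N n)"
    using assms unfolding meager_def by blast
  have "\<exists>l t. \<forall>n\<le>m. \<forall>e. matches e t {m..<l} \<longrightarrow> e \<notin> N n" for m
  proof -
    \<comment> \<open>All prefixes of length \<open>m\<close>, continued by
      \<open>False\<close>.\<close>
    let ?S = "(\<lambda>A i. i \<in> A) ` Pow {..<m} :: (nat \<Rightarrow> bool) set"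
    let ?P = "?S \<times> N ` {..m}"
    have "\<exists>l\<ge>m. \<exists>t. \<forall>(s, X)\<in>?P. \<forall>e\<in>cylinder s m. matches e t {m..<l} \<longrightarrow> e \<notin> X"
      by (rule common_escape) (use N(1) in auto)
    then obtain l t where lt: "\<And>s X e. (s, X) \<in> ?P \<Longrightarrow> e \<in> cylinder s m \<Longrightarrow>
        matches e t {m..<l} \<Longrightarrow> e \<notin> X"
      by blast
    have "e \<notin> N n" if "n \<le> m" "matches e t {m..<l}" for n e
    proof (rule lt[OF _ _ that(2)])
      show "((\<lambda>i. i \<in> {j. j < m \<and> e j}), N n) \<in> ?P"
        using that(1) by (intro SigmaI image_eqI[where x = "{j. j < m \<and> e j}"]) auto
      show "e \<in> cylinder (\<lambda>i. i \<in> {j. j < m \<and> e j}) m"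
        by (auto simp: cylinder_def)
    qed
    then show ?thesis by blast
  qed
  then obtain l t where lt: "\<And>m n e. n \<le> m \<Longrightarrow> matches e (t m) {m..<l m} \<Longrightarrow> e \<notin> N n"
    by metis
  \<comment> \<open>The running maximum gives monotonicity; longer intervals are only harder to
    match.\<close>
  define f where "f m = Max (l ` {..m})" for m :: nat
  have "mono f"
    unfolding f_def by (intro monoI Max_mono) auto
  moreover have "\<exists>r. \<forall>m\<ge>r. \<not> matches e (t m) {m..<f m}" if "e \<in> M" for e
  proof -
    obtain r where r: "e \<in> N r" using N(2) \<open>e \<in> M\<close> by (meson UN_E subsetD)
    have "\<not> matches e (t m) {m..<f m}" if "m \<ge> r" for m
    proof
      assume "matches e (t m) {m..<f m}"
      moreover have "l m \<le> f m" unfolding f_def by (intro Max_ge) auto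
      ultimately have "matches e (t m) {m..<l m}"
        by (elim matches_subset) auto
      then show False using lt r that by blast
    qed
    then show ?thesis by blast
  qed
  ultimately show thesis using that by blast
qed

section \<open>From a winning strategy to a meager cover\<close>

text \<open>The default 0 gives every point a legal play, so that plays can cover the whole
  space.\<close>

definition row_least :: "(nat \<Rightarrow> bool) \<Rightarrow> nat \<Rightarrow> nat" where
  "row_least c k =
    (if \<exists>n. c (prod_encode (k, n)) then LEAST n. c (prod_encode (k, n)) else 0)"

text \<open>Reading a point of Cantor space as a zero-one matrix turns it into a play of Player I.\<close>

definition play_of :: "(nat \<Rightarrow> bool) \<Rightarrow> nat \<Rightarrow> nat set" where
  "play_of c k = {row_least c k..row_least c k + k}"

lemma legal_play_of: "legal_I_play (play_of c)"
  by (simp add: legal_I_play_def play_of_def)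

lemma row_least_eqI:
  assumes "c (prod_encode (k, n))" "\<And>j. j < n \<Longrightarrow> \<not> c (prod_encode (k, j))"
  shows "row_least c k = n"
proof -
  have "(LEAST n. c (prod_encode (k, n))) = n"
    using assms by (intro Least_equality) (auto simp: not_less[symmetric])
  then show ?thesis using assms(1) by (auto simp: row_least_def)
qed

text \<open>The row must contain a \<open>True\<close>: finitely many bits certify its first
  \<open>True\<close>, but never that a row is empty.\<close>

lemma row_least_locally_constant:
  assumes "c (prod_encode (k, n))"
    and "\<And>j. j \<le> row_least c k \<Longrightarrow> d (prod_encode (k, j)) = c (prod_encode (k, j))"
  shows "row_least d k = row_least c k"
proof (rule row_least_eqI)
  have eq: "row_least c k = (LEAST n. c (prod_encode (k, n)))"
    using assms(1) by (auto simp: row_least_def)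
  show "d (prod_encode (k, row_least c k))"
    using assms LeastI[of "\<lambda>n. c (prod_encode (k, n))" n] eq by simp
  show "\<not> d (prod_encode (k, j))" if "j < row_least c k" for j
    using assms(2)[of j] that not_less_Least[of j "\<lambda>n. c (prod_encode (k, n))"] eq by simp
qed

definition consistent_plays :: "(nat set list \<Rightarrow> bool) \<Rightarrow> (nat \<Rightarrow> nat) \<Rightarrow> (nat \<Rightarrow> bool) set" where
  "consistent_plays \<sigma> x =
    {c. {k. II_moves \<sigma> (play_of c) k} = {k. x k \<notin> play_of c k}}"

text \<open>If the plays consistent with \<^term>\<open>x\<close> were dense in some cylinder, Player I could start
  inside that cylinder and then put \<^term>\<open>x k\<close> into every further move, so that a winning strategy
  must at some point answer 1 although \<^term>\<open>x\<close> was caught.\<close>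

lemma nowhere_dense_consistent_plays:
  assumes win: "II_winning_strategy A \<sigma>"
  shows "nowhere_dense (consistent_plays \<sigma> x)"
  unfolding nowhere_dense_iff_cylinder
proof (intro allI)
  fix c m
  \<comment> \<open>Rows from \<open>m\<close> on lie wholly beyond the prefix, as a code is at
    least its row number; their only \<open>True\<close> is at \<open>x k\<close>. Earlier rows are
    filled with \<open>True\<close> beyond the prefix, so none is empty.\<close>
  define d where "d e = (if e < m then c e
      else case prod_decode e of (k, n) \<Rightarrow> k < m \<or> n = x k)" for e
  have d_row: "row_least d k = x k" if "m \<le> k" for k
  proof (rule row_least_eqI)
    have *: "\<not> prod_encode (k, j) < m" for j
      using le_prod_encode_1[of k j] that by linarith
    show "d (prod_encode (k, x k))" "\<And>j. j < x k \<Longrightarrow> \<not> d (prod_encode (k, j))"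
      using * that by (auto simp: d_def)
  qed
  have d_true: "\<exists>n. d (prod_encode (k, n))" for k
  proof -
    define n where "n = (if k < m then m else x k)"
    have "\<not> prod_encode (k, n) < m"
      using le_prod_encode_1[of k n] le_prod_encode_2[of n k] by (auto simp: n_def)
    then have "d (prod_encode (k, n))" by (auto simp: d_def n_def)
    then show ?thesis ..
  qed
  have "infinite {k. II_moves \<sigma> (play_of d) k}"
    using win legal_play_of unfolding II_winning_strategy_def II_wins_play_def by blast
  then obtain k where k: "k \<ge> m" "II_moves \<sigma> (play_of d) k"
    unfolding infinite_nat_iff_unbounded_le by auto
  have xk: "x k \<in> play_of d k"
    using d_row[OF k(1)] by (simp add: play_of_def)
  \<comment> \<open>The bits below \<open>b\<close> determine the moves 0 to \<open>k\<close>, hence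
    also the answer in round \<open>k\<close>.\<close>
  have "finite (prod_encode ` (SIGMA j:{..k}. {..row_least d j}))"
    by auto
  then obtain b where "\<forall>p\<in>prod_encode ` (SIGMA j:{..k}. {..row_least d j}). p < b"
    unfolding finite_nat_set_iff_bounded by (rule exE)
  then have b: "prod_encode (j, n) < b" if "j \<le> k" "n \<le> row_least d j" for j n
    using that by blast
  have "cylinder d (max m b) \<inter> consistent_plays \<sigma> x = {}"
  proof (rule ccontr)
    assume "\<not> ?thesis"
    then obtain e where e: "e \<in> cylinder d (max m b)" "e \<in> consistent_plays \<sigma> x" by blast
    have "row_least e j = row_least d j" if "j \<le> k" for j
    proof -
      obtain n where "d (prod_encode (j, n))" using d_true by blast
      then show ?thesis
      proof (rule row_least_locally_constant)
        fix l assume "l \<le> row_least d j"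
        then have "prod_encode (j, l) < max m b" using b[OF that] by (simp add: less_max_iff_disj)
        then show "e (prod_encode (j, l)) = d (prod_encode (j, l))"
          using e(1) unfolding cylinder_def by blast
      qed
    qed
    then have same: "play_of e j = play_of d j" if "j \<le> k" for j
      using that by (simp add: play_of_def)
    then have "map (play_of e) [0..<Suc k] = map (play_of d) [0..<Suc k]"
      by (intro map_cong) auto
    then have "II_moves \<sigma> (play_of e) k"
      using k(2) unfolding II_moves_def by (simp only:)
    then have "x k \<notin> play_of e k"
      using e(2) unfolding consistent_plays_def by blast
    then show False using xk same by simp
  qed
  moreover have "d \<in> cylinder c m" by (simp add: cylinder_def d_def)
  ultimately show "\<exists>d m'. d \<in> cylinder c m \<and> m \<le> m' \<and> cylinder d m' \<inter> consistent_plays \<sigma> x = {}"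
    using max.cobounded1 by blast
qed

lemma nowhere_dense_imp_meager: "nowhere_dense X \<Longrightarrow> meager X"
  unfolding meager_def by (rule exI[of _ "\<lambda>_. X"]) auto

lemma meager_cover_from_strategy:
  assumes "II_has_winning_strategy A"
  obtains F where "meager_cover F" "(card_of F, card_of A) \<in> ordLeq"
proof -
  obtain \<sigma> where win: "II_winning_strategy A \<sigma>"
    using assms unfolding II_has_winning_strategy_def by blast
  have "c \<in> (\<Union>x\<in>A. consistent_plays \<sigma> x)" for c
    using win legal_play_of[of c]
    unfolding II_winning_strategy_def II_wins_play_def consistent_plays_def by blast
  then have "meager_cover (consistent_plays \<sigma> ` A)"
    unfolding meager_cover_def
    using nowhere_dense_imp_meager nowhere_dense_consistent_plays[OF win] by auto
  then show thesis using that card_of_image by blast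
qed

section \<open>From a meager cover to a winning strategy\<close>

text \<open>The extra index \<open>i\<close> gives each member countably many functions; one catch
  for each then replaces catching infinitely often.\<close>

definition catchable :: "'a set \<Rightarrow> bool" where
  "catchable F \<longleftrightarrow> (\<forall>x :: 'a \<Rightarrow> nat \<Rightarrow> nat \<Rightarrow> nat.
     \<exists>a. legal_I_play a \<and> (\<forall>M\<in>F. \<forall>i. \<exists>k. x M i k \<in> a k))"

lemma strategy_from_escaping:
  assumes "\<And>a. legal_I_play a \<Longrightarrow> \<exists>x\<in>A. \<forall>k. x k \<notin> a k"
  shows "II_has_winning_strategy A"
  unfolding II_has_winning_strategy_def II_winning_strategy_def II_wins_play_def II_moves_def
  using assms by (intro exI[of _ "\<lambda>_. True"]) (auto simp: set_eq_iff)

lemma strategy_from_not_catchable: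
  assumes "\<not> catchable F"
  obtains A where "II_has_winning_strategy A" "(card_of A, card_of (F \<times> (UNIV :: nat set))) \<in> ordLeq"
proof -
  from assms[unfolded catchable_def not_all] obtain x :: "'a \<Rightarrow> nat \<Rightarrow> nat \<Rightarrow> nat"
    where "\<nexists>a. legal_I_play a \<and> (\<forall>M\<in>F. \<forall>i. \<exists>k. x M i k \<in> a k)" by (rule exE)
  then have x: "\<exists>M\<in>F. \<exists>i. \<forall>k. x M i k \<notin> a k" if "legal_I_play a" for a
    using that by blast
  have "II_has_winning_strategy ((\<lambda>(M, i). x M i) ` (F \<times> UNIV))"
  proof (rule strategy_from_escaping)
    fix a assume "legal_I_play a"
    then obtain M i where "M \<in> F" "\<forall>k. x M i k \<notin> a k" using x by blast
    then show "\<exists>y\<in>(\<lambda>(M, i). x M i) ` (F \<times> UNIV). \<forall>k. y k \<notin> a k"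
      by (intro bexI[of _ "x M i"]) (auto intro!: image_eqI[where x = "(M, i)"])
  qed
  then show thesis using that card_of_image by blast
qed

text \<open>Move \<open>k\<close> is spent on the \<open>k\<close>-th pair of an enumeration. This
  makes a cover that is not catchable infinite, so that the factor \<omega> does not increase its
  cardinality.\<close>

lemma countable_catchable:
  assumes "countable F"
  shows "catchable F"
  unfolding catchable_def
proof
  fix x :: "'a \<Rightarrow> nat \<Rightarrow> nat \<Rightarrow> nat"
  define g where "g = from_nat_into (F \<times> (UNIV :: nat set))"
  define a where "a k = (let y = x (fst (g k)) (snd (g k)) k in {y..y + k})" for k
  have "legal_I_play a" by (simp add: legal_I_play_def a_def Let_def)
  moreover have "\<exists>k. x M i k \<in> a k" if "M \<in> F" for M i
  proof -
    have "countable (F \<times> (UNIV :: nat set))" using assms by auto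
    then obtain k where "g k = (M, i)"
      using from_nat_into_surj[of "F \<times> UNIV" "(M, i)"] \<open>M \<in> F\<close> unfolding g_def by auto
    then have "x M i k \<in> a k" by (simp add: a_def Let_def)
    then show ?thesis ..
  qed
  ultimately show "\<exists>a. legal_I_play a \<and> (\<forall>M\<in>F. \<forall>i. \<exists>k. x M i k \<in> a k)"
    by blast
qed

section \<open>Interval partitions from caught growth functions\<close>

lemma strict_mono_locate:
  fixes J :: "nat \<Rightarrow> nat"
  assumes "strict_mono J" "J 0 = 0"
  obtains n where "J n \<le> k" "k < J (Suc n)"
proof -
  define n where "n = (LEAST n. k < J (Suc n))"
  have "k < J (Suc k)" using strict_mono_imp_increasing[OF assms(1), of "Suc k"] by simp
  then have 1: "k < J (Suc n)" unfolding n_def by (rule LeastI)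
  have "J n \<le> k"
  proof (cases n)
    case 0
    then show ?thesis using assms(2) by simp
  next
    case (Suc p)
    then have "\<not> k < J (Suc p)" using not_less_Least[of p "\<lambda>n. k < J (Suc n)"] n_def by simp
    then show ?thesis using Suc by simp
  qed
  with 1 show thesis using that by blast
qed

text \<open>Catching \<^term>\<open>f M \<circ> f M\<close> rather than \<^term>\<open>f M\<close> makes a long interval end within two
  consecutive blocks, so that one of these two blocks already contains such an interval.\<close>

lemma catchable_blocks:
  fixes f :: "'a \<Rightarrow> nat \<Rightarrow> nat"
  assumes "catchable F" and mono: "\<And>M. M \<in> F \<Longrightarrow> mono (f M)"
  obtains J where "strict_mono J" "J 0 = 0"
    "\<And>M i. M \<in> F \<Longrightarrow> \<exists>n\<ge>i. f M (J n) \<le> J (Suc n)"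
proof -
  obtain a where a: "legal_I_play a" "\<And>M i. M \<in> F \<Longrightarrow> \<exists>k. f M (f M (k + i)) \<in> a k"
    using assms(1)[unfolded catchable_def, rule_format, of "\<lambda>M i k. f M (f M (k + i))"] by blast
  \<comment> \<open>The sum bounds all elements of \<open>a k\<close> and is monotone in
    \<open>k\<close>; \<open>Suc k\<close> makes the iterates strictly increase.\<close>
  define h where "h k = Suc k + (\<Sum>j\<le>k. \<Sum>(a j))" for k
  have h_ge: "y \<le> h k" if "y \<in> a k" for y k
  proof -
    have "y \<le> \<Sum>(a k)"
      using that a(1) by (intro member_le_sum) (auto simp: legal_I_play_def)
    also have "\<dots> \<le> (\<Sum>j\<le>k. \<Sum>(a j))" by (rule member_le_sum) auto
    finally show ?thesis by (simp add: h_def)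
  qed
  have h_mono: "h k \<le> h l" if "k \<le> l" for k l
    unfolding h_def using that by (intro add_mono sum_mono2) auto
  define J where "J n = (h ^^ n) 0" for n
  have J_Suc: "J (Suc n) = h (J n)" for n by (simp add: J_def)
  have J: "strict_mono J"
    by (rule strict_monoI_Suc) (simp add: J_Suc h_def)
  have J0: "J 0 = 0" by (simp add: J_def)
  have "\<exists>n\<ge>i. f M (J n) \<le> J (Suc n)" if M: "M \<in> F" for M i
  proof -
    \<comment> \<open>The shift by \<open>J i\<close> forces the block found to have index at least
      \<open>i\<close>.\<close>
    obtain k where k: "f M (f M (k + J i)) \<in> a k" using a(2)[OF M] by blast
    obtain n where n: "J n \<le> k + J i" "k + J i < J (Suc n)"
      using strict_mono_locate[OF J J0] by blast
    have "J i < J (Suc n)" using n(2) by linarith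
    then have "i \<le> n" using strict_mono_less[OF J] by auto
    note fm = monoD[OF mono[OF M]]
    have "f M (f M (J n)) \<le> f M (f M (k + J i))" using n(1) by (intro fm)
    also have "\<dots> \<le> h k" using k by (rule h_ge)
    also have "\<dots> \<le> h (J (Suc n))" using n(2) by (intro h_mono) auto
    finally have two: "f M (f M (J n)) \<le> J (Suc (Suc n))" by (simp add: J_Suc)
    show ?thesis
    proof (cases "f M (J n) \<le> J (Suc n)")
      case True
      then show ?thesis using \<open>i \<le> n\<close> by blast
    next
      case False
      then have "f M (J (Suc n)) \<le> f M (f M (J n))" by (intro fm) auto
      then show ?thesis using two \<open>i \<le> n\<close> by (intro exI[of _ "Suc n"]) auto
    qed
  qed
  then show thesis using that J J0 by blast
qed

section \<open>Escaping all meager sets of the family at once\<close>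

fun distinct_reps :: "(nat \<Rightarrow> nat set) \<Rightarrow> nat \<Rightarrow> nat" where
  "distinct_reps D q = (LEAST n. n \<in> D q \<and> (\<forall>p\<in>{..<q}. n \<noteq> distinct_reps D p))"

declare distinct_reps.simps [simp del]

text \<open>The greedy choice never gets stuck: the \<open>q\<close> earlier representatives cannot
  exhaust a set with more than \<open>q\<close> elements.\<close>

lemma distinct_reps:
  assumes "\<And>q. infinite (D q) \<or> q < card (D q)"
  shows "distinct_reps D q \<in> D q" "inj (distinct_reps D)"
proof -
  have *: "distinct_reps D q \<in> D q \<and> (\<forall>p\<in>{..<q}. distinct_reps D q \<noteq> distinct_reps D p)" for q
  proof -
    have "\<not> D q \<subseteq> distinct_reps D ` {..<q}"
    proof
      assume sub: "D q \<subseteq> distinct_reps D ` {..<q}"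
      then have "card (D q) \<le> q"
        using card_mono[OF _ sub] card_image_le[of "{..<q}" "distinct_reps D"] by simp
      moreover have "finite (D q)" using finite_subset[OF sub] by simp
      ultimately show False using assms[of q] by simp
    qed
    then have "\<exists>n. n \<in> D q \<and> (\<forall>p\<in>{..<q}. n \<noteq> distinct_reps D p)" by blast
    from LeastI_ex[OF this] show ?thesis
      unfolding distinct_reps.simps[of D q] .
  qed
  show "distinct_reps D q \<in> D q" using * by blast
  show "inj (distinct_reps D)"
  proof (rule linorder_injI)
    fix p q :: nat
    assume "p < q"
    then show "distinct_reps D p \<noteq> distinct_reps D q" using *[of q] by (metis lessThan_iff)
  qed
qed

text \<open>A value caught by Player I encodes sufficiently many blocks together with a guess on them.
  The candidates of all moves are enumerated in one sequence, and each candidate is granted one of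
  its blocks that no earlier candidate has used; the new point follows the guess there.\<close>

lemma catchable_meager_not_cover:
  assumes F: "catchable F" and meager: "\<And>M. M \<in> F \<Longrightarrow> meager M"
  shows "\<Union>F \<noteq> UNIV"
proof -
  have "\<exists>f t. mono (f :: nat \<Rightarrow> nat) \<and>
      (\<forall>e\<in>M. \<exists>r. \<forall>m\<ge>r. \<not> matches e (t m) {m..<f m})" if "M \<in> F" for M
    by (rule meager_escape_intervals[OF meager[OF that]]) blast
  then obtain f t where mono: "\<And>M. M \<in> F \<Longrightarrow> mono (f M :: nat \<Rightarrow> nat)"
    and escape: "\<And>M e. M \<in> F \<Longrightarrow> e \<in> M \<Longrightarrow> \<exists>r. \<forall>m\<ge>r. \<not> matches e (t M m) {m..<f M m}"
    by metis
  obtain J where J: "strict_mono J" "J 0 = 0"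
    and long: "\<And>M i. M \<in> F \<Longrightarrow> \<exists>n\<ge>i. f M (J n) \<le> J (Suc n)"
    using catchable_blocks[of F f, OF F mono] by blast
  define blk where "blk n = {J n..<J (Suc n)}" for n
  define idx where "idx i = (LEAST n. i < J (Suc n))" for i
  have idx: "idx i = n" if "i \<in> blk n" for i n
    unfolding idx_def
  proof (rule Least_equality)
    show "i < J (Suc n)" using that by (simp add: blk_def)
    fix p assume "i < J (Suc p)"
    then have "J n < J (Suc p)" using that by (simp add: blk_def)
    then show "n \<le> p" using strict_mono_less[OF J(1)] by auto
  qed
  define good where "good M i = {n. i \<le> n \<and> f M (J n) \<le> J (Suc n)}" for M i
  have "infinite (good M i)" if "M \<in> F" for M i
    unfolding infinite_nat_iff_unbounded_le
  proof
    fix m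
    show "\<exists>n\<ge>m. n \<in> good M i" using long[OF that, of "max i m"] by (auto simp: good_def)
  qed
  \<comment> \<open>A value caught in move \<open>k\<close> will have a number
    \<open>prod_encode (k, j)\<close> with \<open>j\<close> at most \<open>k\<close>. The sum bounds
    all of these, so the greedy choice will find a free block.\<close>
  then have "\<exists>D. M \<in> F \<longrightarrow> D \<subseteq> good M i \<and> finite D \<and> card D = Suc (\<Sum>j\<le>k. prod_encode (k, j))"
    for M i k
    using infinite_arbitrarily_large by metis
  then obtain D where D: "\<And>M i k. M \<in> F \<Longrightarrow> D M i k \<subseteq> good M i"
    "\<And>M i k. M \<in> F \<Longrightarrow> finite (D M i k)"
    "\<And>M i k. M \<in> F \<Longrightarrow> card (D M i k) = Suc (\<Sum>j\<le>k. prod_encode (k, j))"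
    by metis
  \<comment> \<open>On each block \<open>n\<close> of \<open>D M i k\<close> the guess copies the
    pattern attached to the left endpoint \<open>J n\<close>.\<close>
  define guess where "guess M i k = {j \<in> (\<Union>n\<in>D M i k. blk n). t M (J (idx j)) j}" for M i k
  have fin_guess: "finite (guess M i k)" if "M \<in> F" for M i k
    using D(2)[OF that] by (auto simp: guess_def blk_def)
  obtain a where a: "legal_I_play a" and
    hit: "\<And>M i. M \<in> F \<Longrightarrow>
      \<exists>k. prod_encode (set_encode (D M i k), set_encode (guess M i k)) \<in> a k"
    using F[unfolded catchable_def, rule_format,
        of "\<lambda>M i k. prod_encode (set_encode (D M i k), set_encode (guess M i k))"] by blast
  \<comment> \<open>Candidate number \<open>prod_encode (k, j)\<close> is the \<open>j\<close>-th
    element of \<open>a k\<close>, read as a set of blocks with a guess.\<close>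
  define y where "y q = (case prod_decode q of (k, j) \<Rightarrow>
      prod_decode (sorted_list_of_set (a k) ! j))" for q
  \<comment> \<open>Candidates with too few blocks get \<open>UNIV\<close>, so that representatives
    exist for every \<open>q\<close>.\<close>
  define E where "E q = (let B = set_decode (fst (y q)) in if q < card B then B else UNIV)" for q
  have "infinite (E q) \<or> q < card (E q)" for q
    by (simp add: E_def Let_def)
  note reps = distinct_reps[of E, OF this]
  \<comment> \<open>The inverse finds the candidate owning the block of \<open>i\<close>; on blocks
    without an owner the value is irrelevant.\<close>
  define z where "z i \<longleftrightarrow> i \<in> set_decode (snd (y (inv (distinct_reps E) (idx i))))" for i
  have "z \<notin> M" if M: "M \<in> F" for M
  proof
    assume "z \<in> M"
    then obtain r where r: "\<And>m. m \<ge> r \<Longrightarrow> \<not> matches z (t M m) {m..<f M m}"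
      using escape[OF M] by blast
    \<comment> \<open>Catching at index \<open>r\<close> yields blocks numbered at least
      \<open>r\<close>, which start at or after \<open>r\<close>.\<close>
    obtain k where k: "prod_encode (set_encode (D M r k), set_encode (guess M r k)) \<in> a k"
      (is "?v \<in> _") using hit[OF M] by blast
    have ak: "finite (a k)" "card (a k) = Suc k" using a by (auto simp: legal_I_play_def)
    then obtain j where j: "j \<le> k" "sorted_list_of_set (a k) ! j = ?v"
      using k by (metis in_set_conv_nth less_Suc_eq_le length_sorted_list_of_set
          set_sorted_list_of_set)
    define q where "q = prod_encode (k, j)"
    have yq: "y q = (set_encode (D M r k), set_encode (guess M r k))"
      using j(2) by (simp add: y_def q_def)
    have "q \<le> (\<Sum>j\<le>k. prod_encode (k, j))"
      unfolding q_def using j(1) by (intro member_le_sum) auto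
    then have Eq: "E q = D M r k"
      using yq D(2,3)[OF M] by (simp add: E_def)
    define n where "n = distinct_reps E q"
    have n: "n \<in> D M r k" using reps(1)[of q] Eq by (simp add: n_def)
    then have ng: "r \<le> n" "f M (J n) \<le> J (Suc n)" using D(1)[OF M] by (auto simp: good_def)
    have "z i = t M (J n) i" if "i \<in> blk n" for i
    proof -
      have "inv (distinct_reps E) (idx i) = q"
        using idx[OF that] reps(2) by (simp add: n_def)
      then have "z i \<longleftrightarrow> i \<in> guess M r k"
        using fin_guess[OF M] by (simp add: z_def yq)
      also have "\<dots> \<longleftrightarrow> t M (J n) i"
        using that n idx[OF that] by (auto simp: guess_def)
      finally show ?thesis .
    qed
    then have "matches z (t M (J n)) {J n..<f M (J n)}"
      using ng(2) by (auto simp: matches_def blk_def)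
    moreover have "r \<le> J n"
      using ng(1) strict_mono_imp_increasing[OF J(1), of n] by linarith
    ultimately show False using r by blast
  qed
  then show ?thesis by blast
qed

lemma strategy_from_meager_cover:
  assumes "meager_cover F"
  obtains A where "II_has_winning_strategy A" "(card_of A, card_of F) \<in> ordLeq"
proof -
  have nc: "\<not> catchable F"
    using assms catchable_meager_not_cover[of F] unfolding meager_cover_def by blast
  then have "infinite F"
    using countable_catchable countable_finite by blast
  then have "(card_of (F \<times> (UNIV :: nat set)), card_of F) \<in> ordIso"
    using card_of_Times_infinite_simps(1) infinite_iff_card_of_nat by blast
  then show thesis
    using strategy_from_not_catchable[OF nc] that ordLeq_ordIso_trans by metis
qed

section \<open>Existence of the minima and comparison of the two cardinals\<close>

lemma minimal_cardinality_exists: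
  assumes "P A"
  obtains B where "P B" "\<And>C. P C \<Longrightarrow> (card_of B, card_of C) \<in> ordLeq"
proof -
  have "\<exists>r\<in>card_of ` Collect P. \<forall>r'\<in>card_of ` Collect P. (r, r') \<in> ordLeq"
    by (rule exists_minim_Well_order) (use assms in \<open>auto simp: card_of_Well_order\<close>)
  then show thesis using that by blast
qed

theorem mainTheorem10:
  shows "(\<exists>A. addN_game_II_witness A) \<and> (\<exists>F. cov_M_witness F) \<and>
         (\<forall>A F. addN_game_II_witness A \<longrightarrow> cov_M_witness F \<longrightarrow> (card_of A, card_of F) \<in> ordIso)"
proof -
  have "\<exists>x. \<forall>k. x k \<notin> a k" if "legal_I_play a" for a
  proof (rule choice, rule allI)
    show "\<exists>y. y \<notin> a k" for k
      using that ex_new_if_finite[OF infinite_UNIV_nat, of "a k"] by (simp add: legal_I_play_def)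
  qed
  then have "II_has_winning_strategy UNIV"
    by (intro strategy_from_escaping) blast
  then obtain A where A: "II_has_winning_strategy A"
    "\<And>B. II_has_winning_strategy B \<Longrightarrow> (card_of A, card_of B) \<in> ordLeq"
    using minimal_cardinality_exists[of II_has_winning_strategy] by blast
  have ex_A: "addN_game_II_witness A"
    using A unfolding addN_game_II_witness_def by blast
  obtain F where F: "meager_cover F"
    using meager_cover_from_strategy[OF A(1)] by blast
  then obtain F where F: "meager_cover F"
    "\<And>G. meager_cover G \<Longrightarrow> (card_of F, card_of G) \<in> ordLeq"
    using minimal_cardinality_exists[of meager_cover] by blast
  have ex_F: "cov_M_witness F"
    using F unfolding cov_M_witness_def by blast
  have "(card_of A, card_of F) \<in> ordIso"
    if A: "addN_game_II_witness A" and F: "cov_M_witness F" for A F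
  proof -
    obtain G where G: "meager_cover G" "(card_of G, card_of A) \<in> ordLeq"
      using A meager_cover_from_strategy unfolding addN_game_II_witness_def by blast
    obtain B where B: "II_has_winning_strategy B" "(card_of B, card_of F) \<in> ordLeq"
      using F strategy_from_meager_cover unfolding cov_M_witness_def by blast
    \<comment> \<open>Minimality closes the cycle |F| \<le> |G| \<le> |A| \<le> |B| \<le>
      |F|.\<close>
    have "(card_of F, card_of G) \<in> ordLeq" "(card_of A, card_of B) \<in> ordLeq"
      using A F G(1) B(1) unfolding addN_game_II_witness_def cov_M_witness_def by blast+
    then show ?thesis
      using G(2) B(2) ordLeq_transitive ordIso_iff_ordLeq by metis
  qed
  then show ?thesis using ex_A ex_F by blast
qed

end
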